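(* Let $\mathcal G$ be a connected weighted graph on $n$ nodes, let $\beta>0$, and let $\mathcal P$ be a connected spanning subgraph of $\mathcal G$ (same node set, a subset of the edges, each with its weight in $\mathcal G$). Then $$\rho_{ss}(A^{(2)}_{\mathcal G};M_n\oplus 0)\ \le\ \rho_{ss}(A^{(2)}_{\mathcal P};M_n\oplus 0),$$ $$\rho_{ss}(A^{(2)}_{\mathcal G};0\oplus M_n)\ \le\ \rho_{ss}(A^{(2)}_{\mathcal P};0\oplus M_n).$$ Moreover, the equalities hold if and only if $\mathcal G=\mathcal P$.
   Context: Graphs are finite, simple, undirected, with positive edge weights. For a connected weighted graph $\mathcal H$ on $n$ nodes, the Laplacian $L_{\mathcal H}$ is (diagonal matrix of weighted degrees) minus (weighted adjacency matrix), with eigenvalues $0=\lambda_1<\lambda_2\le\dots\le\lambda_n$, and $M_n=I_n-\frac1nJ_n$ is the centering matrix. For the Type 2 second-order consensus network $\dot x=v$, $\dot v=-L_{\mathcal H}x-\beta L_{\mathcal H}v+\xi$, the performance measures with outputs $M_nx$ and $M_nv$ are respectively $\rho_{ss}(A^{(2)}_{\mathcal H};M_n\oplus 0)=\frac1{2\beta}\sum_{i=2}^n\lambda_i^{-2}$ and $\rho_{ss}(A^{(2)}_{\mathcal H};0\oplus M_n)=\frac1{2\beta}\sum_{i=2}^n\lambda_i^{-1}$. *)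

theory Defs
  imports "Jordan_Normal_Form.Char_Poly"
begin

text \<open>
  Weighted graphs on the node set \<open>{..<n}\<close>. Weights are required to vanish outside the edge set,
  so that equality of records is equality of weighted graphs.
\<close>

record wgraph =
  edges :: "nat set set"
  weight :: "nat set \<Rightarrow> real"

definition weighted_graph :: "nat \<Rightarrow> wgraph \<Rightarrow> bool" where
  "weighted_graph n G \<longleftrightarrow>
     edges G \<subseteq> {e. e \<subseteq> {..<n} \<and> card e = 2} \<and>
     (\<forall>e \<in> edges G. weight G e > 0) \<and>
     (\<forall>e. e \<notin> edges G \<longrightarrow> weight G e = 0)"

definition connected_graph :: "nat \<Rightarrow> wgraph \<Rightarrow> bool" where
  "connected_graph n G \<longleftrightarrow>
     (\<forall>i<n. \<forall>j<n. (i, j) \<in> {(u, v). {u, v} \<in> edges G}\<^sup>*)"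

definition spanning_subgraph :: "wgraph \<Rightarrow> wgraph \<Rightarrow> bool" where
  "spanning_subgraph P G \<longleftrightarrow>
     edges P \<subseteq> edges G \<and> (\<forall>e \<in> edges P. weight P e = weight G e)"

definition weighted_degree :: "wgraph \<Rightarrow> nat \<Rightarrow> real" where
  "weighted_degree G i = (\<Sum>e \<in> {e \<in> edges G. i \<in> e}. weight G e)"

definition adjacency_matrix :: "nat \<Rightarrow> wgraph \<Rightarrow> real mat" where
  "adjacency_matrix n G =
     mat n n (\<lambda>(i, j). if {i, j} \<in> edges G then weight G {i, j} else 0)"

definition laplacian :: "nat \<Rightarrow> wgraph \<Rightarrow> real mat" where
  "laplacian n G = mat_diag n (weighted_degree G) - adjacency_matrix n G"

text \<open>
  The \<open>i\<close>-th smallest Laplacian eigenvalue, \<open>1 \<le> i \<le> n\<close>, counted with algebraic multiplicity.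
  The Laplacian is real symmetric, so all \<open>n\<close> roots of its characteristic polynomial are real and
  \<^const>\<open>proots\<close> over the reals collects all of them. The list is indexed from \<open>0\<close>.
\<close>

definition laplacian_eigenvalue :: "nat \<Rightarrow> wgraph \<Rightarrow> nat \<Rightarrow> real" where
  "laplacian_eigenvalue n G i =
     sorted_list_of_multiset (proots (char_poly (laplacian n G))) ! (i - 1)"

text \<open>
  Steady-state performance of the second-order consensus network
  \<open>x' = v\<close>, \<open>v' = - L x - \<beta> L v + \<xi>\<close>, in closed form: with output \<open>M\<^sub>n x\<close>
  (the measure \<open>\<rho>\<^sub>s\<^sub>s(A; M\<^sub>n \<oplus> 0)\<close>) and with output \<open>M\<^sub>n v\<close> (the measure \<open>\<rho>\<^sub>s\<^sub>s(A; 0 \<oplus> M\<^sub>n)\<close>),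
  where \<open>M\<^sub>n\<close> is the centering matrix.
\<close>

definition rho_ss_position :: "nat \<Rightarrow> real \<Rightarrow> wgraph \<Rightarrow> real" where
  "rho_ss_position n \<beta> G = 1 / (2 * \<beta>) * (\<Sum>i = 2..n. 1 / (laplacian_eigenvalue n G i)\<^sup>2)"

definition rho_ss_velocity :: "nat \<Rightarrow> real \<Rightarrow> wgraph \<Rightarrow> real" where
  "rho_ss_velocity n \<beta> G = 1 / (2 * \<beta>) * (\<Sum>i = 2..n. 1 / laplacian_eigenvalue n G i)"

end

theory Submission
  imports Defs "Jordan_Normal_Form.Spectral_Radius" "Jordan_Normal_Form.Schur_Decomposition"
begin

text \<open>
  Both performance measures are, up to the factor \<open>1 / (2 * \<beta>)\<close>, spectral sums \<open>\<Sum>i. f (\<lambda>\<^sub>i)\<close> of a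
  function \<open>f\<close> that is convex and strictly decreasing on the positive reals, namely \<open>1 / x\<^sup>2\<close> or \<open>1 / x\<close>.
  Since division by zero yields zero, \<open>f 0 = 0\<close>; as the smallest Laplacian eigenvalue is zero, the
  sum from \<open>i = 2\<close> equals the sum over the whole spectrum, in any order.

  The Laplacian quadratic form is \<open>\<Sum>\<^bsub>{i,j}\<^esub> w\<^bsub>ij\<^esub> (x\<^sub>i - x\<^sub>j)\<^sup>2\<close>, so removing edges can only decrease it:
  \<open>L\<^sub>P \<le> L\<^sub>G\<close>. Let \<open>u\<^sub>i\<close>, \<open>a\<^sub>i\<close> be an orthonormal eigenbasis of \<open>L\<^sub>P\<close> with its eigenvalues, and
  \<open>v\<^sub>j\<close>, \<open>b\<^sub>j\<close> the same for \<open>L\<^sub>G\<close>. The matrix \<open>s\<^bsub>ij\<^esub> = (u\<^sub>i \<bullet> v\<^sub>j)\<^sup>2\<close> is doubly stochastic and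
  \<open>v\<^sub>j \<bullet> L\<^sub>P v\<^sub>j = \<Sum>i. s\<^bsub>ij\<^esub> a\<^sub>i\<close>. For \<open>b\<^sub>j > 0\<close>, averaging the tangent inequality of \<open>f\<close> at \<open>b\<^sub>j\<close> gives
  \<open>\<Sum>i. s\<^bsub>ij\<^esub> f (a\<^sub>i) \<ge> f (b\<^sub>j) + \<bar>f' (b\<^sub>j)\<bar> (b\<^sub>j - v\<^sub>j \<bullet> L\<^sub>P v\<^sub>j) \<ge> f (b\<^sub>j)\<close>,
  and summing over \<open>j\<close> gives the inequality (lemma \<open>spectral_sum_antimono\<close>). The connectedness of \<open>P\<close>
  enters here: the kernel of \<open>L\<^sub>P\<close> consists of constant vectors, which \<open>L\<^sub>G\<close> also annihilates, so
  that \<open>s\<^bsub>ij\<^esub> = 0\<close> whenever \<open>a\<^sub>i = 0 < b\<^sub>j\<close> and the singularity of \<open>f\<close> at zero is never met.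

  In the case of equality \<open>v\<^sub>j \<bullet> (L\<^sub>G - L\<^sub>P) v\<^sub>j = 0\<close> for every \<open>j\<close>. An edge \<open>{k, l}\<close> of \<open>G\<close> missing in \<open>P\<close>
  would force every eigenvector \<open>v\<^sub>j\<close> to agree at \<open>k\<close> and \<open>l\<close>, which is impossible for a basis
  (lemma \<open>laplacian_spectral_sum_subgraph\<close>).

  The eigenbases come from the real spectral theorem, which the first part establishes.
\<close>

section \<open>The spectral theorem for real symmetric matrices\<close>


text \<open>
  Over the complex numbers an eigenvector \<open>x + \<i> y\<close> exists. Comparing \<open>A x \<bullet> y\<close> with \<open>x \<bullet> A y\<close> shows
  that the imaginary part of its eigenvalue is annihilated by \<open>|x|\<^sup>2 + |y|\<^sup>2\<close>; hence the
  eigenvalue is real, and \<open>x\<close> or \<open>y\<close> is a real eigenvector.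
\<close>

lemma real_symmetric_has_eigenvector:
  fixes A :: "real mat"
  assumes A: "A \<in> carrier_mat n n" and sym: "A\<^sup>T = A" and n: "n > 0"
  shows "\<exists>v e. v \<in> carrier_vec n \<and> v \<noteq> 0\<^sub>v n \<and> A *\<^sub>v v = e \<cdot>\<^sub>v v"
proof -
  let ?C = "map_mat complex_of_real A"
  have C: "?C \<in> carrier_mat n n" using A by simp
  from spectrum_non_empty[OF C n] obtain z w where "eigenvector ?C w z"
    by (auto simp: spectrum_def eigenvalue_def)
  hence w: "w \<in> carrier_vec n" "w \<noteq> 0\<^sub>v n" "?C *\<^sub>v w = z \<cdot>\<^sub>v w"
    using A by (auto simp: eigenvector_def)
  define x where "x = map_vec Re w"
  define y where "y = map_vec Im w"
  have x: "x \<in> carrier_vec n" and y: "y \<in> carrier_vec n" using w by (auto simp: x_def y_def)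
  have comp: "(\<Sum>k<n. complex_of_real (A $$ (i,k)) * w $ k) = z * w $ i" if "i < n" for i
  proof -
    have "(?C *\<^sub>v w) $ i = (z \<cdot>\<^sub>v w) $ i" using w by simp
    thus ?thesis using that A w(1) by (simp add: scalar_prod_def atLeast0LessThan)
  qed
  have Ax: "A *\<^sub>v x = Re z \<cdot>\<^sub>v x - Im z \<cdot>\<^sub>v y"
  proof (rule eq_vecI)
    fix i assume "i < dim_vec (Re z \<cdot>\<^sub>v x - Im z \<cdot>\<^sub>v y)"
    hence i: "i < n" using x y by simp
    show "(A *\<^sub>v x) $ i = (Re z \<cdot>\<^sub>v x - Im z \<cdot>\<^sub>v y) $ i"
      using arg_cong[OF comp[OF i], of Re] i A w
      by (simp add: scalar_prod_def atLeast0LessThan x_def y_def)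
  qed (use A x y in auto)
  have Ay: "A *\<^sub>v y = Re z \<cdot>\<^sub>v y + Im z \<cdot>\<^sub>v x"
  proof (rule eq_vecI)
    fix i assume "i < dim_vec (Re z \<cdot>\<^sub>v y + Im z \<cdot>\<^sub>v x)"
    hence i: "i < n" using x y by simp
    show "(A *\<^sub>v y) $ i = (Re z \<cdot>\<^sub>v y + Im z \<cdot>\<^sub>v x) $ i"
      using arg_cong[OF comp[OF i], of Im] i A w
      by (simp add: scalar_prod_def atLeast0LessThan x_def y_def)
  qed (use A x y in auto)
  have "(A *\<^sub>v x) \<bullet> y = x \<bullet> (A *\<^sub>v y)"
    using transpose_vec_mult_scalar[OF A y x] sym by simp
  hence "Im z * (x \<bullet> x + y \<bullet> y) = 0"
    unfolding Ax Ay using x y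
    by (simp add: minus_scalar_prod_distrib[of _ n] scalar_prod_add_distrib[of _ n] algebra_simps)
  moreover have "x \<bullet> x + y \<bullet> y \<noteq> 0"
  proof
    assume "x \<bullet> x + y \<bullet> y = 0"
    moreover have "x \<bullet> x = (\<Sum>k<n. (x $ k)\<^sup>2)" "y \<bullet> y = (\<Sum>k<n. (y $ k)\<^sup>2)"
      using x y by (auto simp: scalar_prod_def atLeast0LessThan power2_eq_square)
    ultimately have "(\<Sum>k<n. (x $ k)\<^sup>2 + (y $ k)\<^sup>2) = 0" by (simp add: sum.distrib)
    hence "\<forall>k<n. (x $ k)\<^sup>2 + (y $ k)\<^sup>2 = 0"
      by (subst (asm) sum_nonneg_eq_0_iff) auto
    hence "w = 0\<^sub>v n" using w(1)
      by (intro eq_vecI) (auto simp: x_def y_def complex_eq_iff)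
    with w show False by simp
  qed
  ultimately have Im: "Im z = 0" by simp
  have "A *\<^sub>v x = Re z \<cdot>\<^sub>v x" "A *\<^sub>v y = Re z \<cdot>\<^sub>v y" 
    unfolding Ax Ay Im using x y by auto
  moreover have "x \<noteq> 0\<^sub>v n \<or> y \<noteq> 0\<^sub>v n"
    using \<open>x \<bullet> x + y \<bullet> y \<noteq> 0\<close> by auto
  ultimately show ?thesis using x y by blast
qed

text \<open>
  Complete \<open>v\<close> to a basis, apply Gram-Schmidt, which keeps the first vector, and normalise.
\<close>

lemma orthogonal_matrix_with_first_column:
  fixes v :: "real vec"
  assumes v: "v \<in> carrier_vec n" and v0: "v \<noteq> 0\<^sub>v n"
  shows "\<exists>W c. W \<in> carrier_mat n n \<and> W\<^sup>T * W = 1\<^sub>m n \<and> col W 0 = c \<cdot>\<^sub>v v"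
proof -
  interpret cof_vec_space n "TYPE(real)" .
  have n: "n > 0" using v v0 by (cases n) auto
  define b where "b = basis_completion v"
  define ws where "ws = gram_schmidt n b"
  note b = basis_completion[OF v v0, folded b_def]
  have ws: "corthogonal ws" "set ws \<subseteq> carrier_vec n" "length ws = n"
    using gram_schmidt_result[OF b(2,4,5) ws_def] b(6) by auto
  have "b = v # tl b" using b(6,7) n by (cases b) auto
  hence "hd ws = v" unfolding ws_def using gram_schmidt_hd[OF v, of "tl b"] by simp
  hence ws0: "ws ! 0 = v" using n ws(3) by (cases ws) auto
  define r where "r j = 1 / sqrt (ws ! j \<bullet> ws ! j)" for j
  define W where "W = mat_of_cols n (map (\<lambda>j. r j \<cdot>\<^sub>v ws ! j) [0..<n])"
  have wsc: "ws ! j \<in> carrier_vec n" if "j < n" for j using ws that by (simp add: subset_eq)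
  have W: "W \<in> carrier_mat n n"
    by (simp add: W_def mat_of_cols_def)
  have colW: "col W j = r j \<cdot>\<^sub>v ws ! j" if "j < n" for j
    using that wsc[OF that] unfolding W_def by (subst col_mat_of_cols) auto
  have orth: "ws ! i \<bullet> ws ! j = 0 \<longleftrightarrow> i \<noteq> j" if "i < n" "j < n" for i j
    using corthogonalD[OF ws(1), of i j] that ws(3) by (simp add: conjugate_vec_def vec_eq_iff)
  have "W\<^sup>T * W = 1\<^sub>m n"
  proof (rule eq_matI)
    fix i j assume "i < dim_row (1\<^sub>m n :: real mat)" "j < dim_col (1\<^sub>m n :: real mat)"
    hence ij: "i < n" "j < n" by auto
    have pos: "ws ! i \<bullet> ws ! i > 0"
    proof -
      have "ws ! i \<bullet> ws ! i \<ge> 0" by (auto simp: scalar_prod_def intro: sum_nonneg)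
      thus ?thesis using orth[of i i] ij by linarith
    qed
    have "(W\<^sup>T * W) $$ (i,j) = r i * (r j * (ws ! i \<bullet> ws ! j))"
      using ij W wsc[of i] wsc[of j]
      by (simp add: colW smult_scalar_prod_distrib[of _ n] scalar_prod_smult_distrib[of _ n])
    also have "\<dots> = (if i = j then 1 else 0)"
      using orth[OF ij] pos by (auto simp: r_def)
    finally show "(W\<^sup>T * W) $$ (i,j) = 1\<^sub>m n $$ (i,j)" using ij by simp
  qed (use W in auto)
  with W colW[OF n] ws0 show ?thesis by metis
qed

text \<open>
  Induction on the dimension. In an orthonormal basis starting with an eigenvector, the first column
  of the matrix is a multiple of the first unit vector; by symmetry so is the first row, and the
  remaining block is symmetric of smaller size.
\<close>

theorem real_symmetric_orthogonally_diagonalizable: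
  fixes A :: "real mat"
  assumes "A \<in> carrier_mat n n" "A\<^sup>T = A"
  shows "\<exists>U D. U \<in> carrier_mat n n \<and> D \<in> carrier_mat n n \<and> U\<^sup>T * U = 1\<^sub>m n \<and>
           diagonal_mat D \<and> A = U * D * U\<^sup>T"
  using assms
proof (induction n arbitrary: A)
  case 0
  hence "A = 1\<^sub>m 0 * A * (1\<^sub>m 0)\<^sup>T" "(1\<^sub>m 0)\<^sup>T * 1\<^sub>m 0 = (1\<^sub>m 0 :: real mat)" "diagonal_mat A"
    by (auto simp: diagonal_mat_def)
  with 0 show ?case by (metis one_carrier_mat)
next
  case (Suc m)
  let ?n = "Suc m"
  note A = Suc.prems(1)
  from real_symmetric_has_eigenvector[OF Suc.prems] obtain v e
    where v: "v \<in> carrier_vec ?n" "v \<noteq> 0\<^sub>v ?n" "A *\<^sub>v v = e \<cdot>\<^sub>v v" by auto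
  from orthogonal_matrix_with_first_column[OF v(1,2)] obtain W c
    where W: "W \<in> carrier_mat ?n ?n" and WW: "W\<^sup>T * W = 1\<^sub>m ?n" and W0: "col W 0 = c \<cdot>\<^sub>v v"
    by auto
  have WT: "W\<^sup>T \<in> carrier_mat ?n ?n" using W by simp
  have WW': "W * W\<^sup>T = 1\<^sub>m ?n" using mat_mult_left_right_inverse[OF WT W WW] .
  define B where "B = W\<^sup>T * A * W"
  have B: "B \<in> carrier_mat ?n ?n" using A W WT by (simp add: B_def)
  have BT: "B\<^sup>T = B"
  proof -
    have "B\<^sup>T = W\<^sup>T * (W\<^sup>T * A)\<^sup>T"
      unfolding B_def by (rule transpose_mult[of _ ?n ?n _ ?n]) (use A W WT in auto)
    also have "(W\<^sup>T * A)\<^sup>T = A * W"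
      using transpose_mult[OF WT A] Suc.prems(2) by simp
    finally show ?thesis unfolding B_def using assoc_mult_mat[OF WT A W] by simp
  qed
  have "col B 0 = W\<^sup>T *\<^sub>v (A *\<^sub>v col W 0)"
    unfolding B_def assoc_mult_mat[OF WT A W]
    using col_mult2[OF WT mult_carrier_mat[OF A W], of 0] col_mult2[OF A W, of 0] by simp
  also have "A *\<^sub>v col W 0 = e \<cdot>\<^sub>v col W 0"
    unfolding W0 using v A by (simp add: mult_mat_vec[of _ ?n ?n] smult_smult_assoc mult.commute)
  also have "W\<^sup>T *\<^sub>v (e \<cdot>\<^sub>v col W 0) = e \<cdot>\<^sub>v col (W\<^sup>T * W) 0"
    using W mult_mat_vec[OF WT, of "col W 0" e] col_mult2[OF WT W, of 0]
    by (simp add: carrier_vecI)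
  finally have col0: "col B 0 = e \<cdot>\<^sub>v unit_vec ?n 0" by (simp add: WW)
  have B0: "B $$ (i, 0) = (if i = 0 then e else 0)" if "i < ?n" for i
    using arg_cong[OF col0, of "\<lambda>u. u $ i"] that B by simp
  have B0': "B $$ (0, i) = (if i = 0 then e else 0)" if "i < ?n" for i
    using B0[OF that] that B arg_cong[OF BT, of "\<lambda>M. M $$ (0,i)"] by simp
  define E where "E = mat m m (\<lambda>(i,j). B $$ (Suc i, Suc j))"
  have E: "E \<in> carrier_mat m m" by (simp add: E_def)
  have ET: "E\<^sup>T = E"
  proof (rule eq_matI)
    fix i j assume "i < dim_row E" "j < dim_col E"
    thus "E\<^sup>T $$ (i,j) = E $$ (i,j)"
      using B arg_cong[OF BT, of "\<lambda>M. M $$ (Suc i,Suc j)"] by (simp add: E_def)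
  qed (auto simp: E_def)
  from Suc.IH[OF E ET] obtain V D where V: "V \<in> carrier_mat m m" "V\<^sup>T * V = 1\<^sub>m m"
    and D: "D \<in> carrier_mat m m" "diagonal_mat D" and EVD: "E = V * D * V\<^sup>T" by auto
  let ?e = "mat 1 1 (\<lambda>_. e)"
  let ?V = "four_block_mat (1\<^sub>m 1) (0\<^sub>m 1 m) (0\<^sub>m m 1) V"
  let ?D = "four_block_mat ?e (0\<^sub>m 1 m) (0\<^sub>m m 1) D"
  have Vc: "?V \<in> carrier_mat ?n ?n" and Dc: "?D \<in> carrier_mat ?n ?n" using V D by auto
  have VT: "?V\<^sup>T = four_block_mat (1\<^sub>m 1) (0\<^sub>m 1 m) (0\<^sub>m m 1) V\<^sup>T"
    using V by (subst transpose_four_block_mat) auto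
  have VTc: "?V\<^sup>T \<in> carrier_mat ?n ?n" using Vc by simp
  have VV: "?V\<^sup>T * ?V = 1\<^sub>m ?n"
    unfolding VT using V by (subst mult_four_block_mat) auto
  have "?V * ?D * ?V\<^sup>T = four_block_mat ?e (0\<^sub>m 1 m) (0\<^sub>m m 1) E"
    unfolding VT EVD using V(1) D(1)
    by (subst mult_four_block_mat, auto)+
  also have "\<dots> = B"
  proof (rule eq_matI)
    fix i j assume "i < dim_row B" "j < dim_col B"
    thus "four_block_mat ?e (0\<^sub>m 1 m) (0\<^sub>m m 1) E $$ (i,j) = B $$ (i,j)"
      using B B0 B0' by (cases i; cases j) (auto simp: E_def)
  qed (use B E in auto)
  finally have BV: "B = ?V * ?D * ?V\<^sup>T" ..
  define U where "U = W * ?V"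
  have U: "U \<in> carrier_mat ?n ?n" using W Vc by (simp add: U_def)
  have UT: "U\<^sup>T = ?V\<^sup>T * W\<^sup>T" unfolding U_def by (rule transpose_mult[OF W Vc])
  have UU: "U\<^sup>T * U = 1\<^sub>m ?n"
  proof -
    have "U\<^sup>T * U = ?V\<^sup>T * (W\<^sup>T * W) * ?V"
      unfolding UT unfolding U_def using W WT Vc VTc
      by (simp add: assoc_mult_mat[of _ ?n ?n _ ?n _ ?n] del: transpose_four_block_mat)
    also have "\<dots> = 1\<^sub>m ?n" by (simp only: WW right_mult_one_mat[OF VTc] VV)
    finally show ?thesis .
  qed
  have "A = (W * W\<^sup>T) * A * (W * W\<^sup>T)" using A by (simp add: WW')
  also have "\<dots> = W * B * W\<^sup>T" unfolding B_def using W WT A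
    by (simp add: assoc_mult_mat[of _ ?n ?n _ ?n _ ?n])
  also have "\<dots> = U * ?D * U\<^sup>T"
    unfolding UT unfolding U_def BV using W WT Vc VTc Dc
    by (simp add: assoc_mult_mat[of _ ?n ?n _ ?n _ ?n] del: transpose_four_block_mat)
  finally have AU: "A = U * ?D * U\<^sup>T" .
  have "diagonal_mat ?D" using D by (auto simp: diagonal_mat_def)
  with U Dc UU AU show ?case by blast
qed



section \<open>Orthonormal eigenbases\<close>

text \<open>
  Vectors and matrices are plain functions restricted to indices below \<open>n\<close>, so that all that follows
  is a matter of exchanging finite sums. The second conjunct, completeness of the family \<open>u\<close>, follows
  from the first by a dimension count; having both at hand spares that count.
\<close>

definition orthonormal_eigenbasis ::
  "nat \<Rightarrow> (nat \<Rightarrow> nat \<Rightarrow> real) \<Rightarrow> (nat \<Rightarrow> nat \<Rightarrow> real) \<Rightarrow> (nat \<Rightarrow> real) \<Rightarrow> bool" where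
  "orthonormal_eigenbasis n A u e \<longleftrightarrow>
     (\<forall>i<n. \<forall>j<n. (\<Sum>k<n. u i k * u j k) = of_bool (i = j)) \<and>
     (\<forall>k<n. \<forall>l<n. (\<Sum>i<n. u i k * u i l) = of_bool (k = l)) \<and>
     (\<forall>i<n. \<forall>k<n. (\<Sum>l<n. A k l * u i l) = e i * u i k)"

definition quadratic_form :: "nat \<Rightarrow> (nat \<Rightarrow> nat \<Rightarrow> real) \<Rightarrow> (nat \<Rightarrow> real) \<Rightarrow> real" where
  "quadratic_form n A x = (\<Sum>k<n. \<Sum>l<n. x k * A k l * x l)"

lemma mset_diag_mat:
  "D \<in> carrier_mat n n \<Longrightarrow> mset (diag_mat D) = image_mset (\<lambda>i. D $$ (i,i)) (mset_set {..<n})"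
  by (simp add: diag_mat_def atLeast0LessThan)

lemma proots_prod_linear: "proots (\<Prod>a\<leftarrow>as. [:- a, 1:]) = mset (as :: real list)"
proof (induction as)
  case (Cons a as)
  have "(\<Prod>a\<leftarrow>as. [:- a, 1:]) \<noteq> 0" by (auto simp: prod_list_zero_iff)
  moreover have "[:-a, 1:] \<noteq> 0" by simp
  ultimately show ?case using Cons by (simp add: proots_mult del: mult_pCons_left)
qed simp

text \<open>
  The diagonalisation in coordinates. The eigenvalues are tied to the roots of the characteristic
  polynomial by similarity to the diagonal matrix, so multiplicities agree.
\<close>

lemma real_symmetric_eigenbasis:
  fixes A :: "real mat"
  assumes A: "A \<in> carrier_mat n n" and sym: "A\<^sup>T = A"
  shows "\<exists>u e. orthonormal_eigenbasis n (\<lambda>k l. A $$ (k,l)) u e \<and>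
           proots (char_poly A) = image_mset e (mset_set {..<n})"
proof -
  from real_symmetric_orthogonally_diagonalizable[OF A sym] obtain U D
    where U: "U \<in> carrier_mat n n" and D: "D \<in> carrier_mat n n"
      and UU: "U\<^sup>T * U = 1\<^sub>m n" and diag: "diagonal_mat D" and AU: "A = U * D * U\<^sup>T" by auto
  have UT: "U\<^sup>T \<in> carrier_mat n n" using U by simp
  have UU': "U * U\<^sup>T = 1\<^sub>m n" using mat_mult_left_right_inverse[OF UT U UU] .
  have "similar_mat A D"
    by (rule similar_matI[of _ _ U "U\<^sup>T" n]) (use A D U UT UU UU' AU in auto)
  moreover have "upper_triangular D" using diag D by (auto simp: diagonal_mat_def)
  ultimately have "char_poly A = (\<Prod>a\<leftarrow>diag_mat D. [:- a, 1:])"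
    using char_poly_similar char_poly_upper_triangular[OF D] by metis
  hence roots: "proots (char_poly A) = image_mset (\<lambda>i. D $$ (i,i)) (mset_set {..<n})"
    using proots_prod_linear mset_diag_mat[OF D] by metis
  have AUD: "A * U = U * D"
  proof -
    have "A * U = U * D * (U\<^sup>T * U)" unfolding AU
      using U D UT by (intro assoc_mult_mat[of _ n n _ n _ n]) auto
    thus ?thesis using U D UU by simp
  qed
  have "(\<Sum>l<n. A $$ (k,l) * U $$ (l,i)) = D $$ (i,i) * U $$ (k,i)" if "i < n" "k < n" for i k
  proof -
    have "(\<Sum>l<n. A $$ (k,l) * U $$ (l,i)) = (A * U) $$ (k,i)"
      using that A U by (simp add: scalar_prod_def atLeast0LessThan)
    also have "\<dots> = (\<Sum>l<n. U $$ (k,l) * D $$ (l,i))"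
      unfolding AUD using that D U by (simp add: scalar_prod_def atLeast0LessThan)
    also have "\<dots> = (\<Sum>l<n. if l = i then U $$ (k,i) * D $$ (i,i) else 0)"
      using diag D that by (intro sum.cong) (auto simp: diagonal_mat_def)
    finally show ?thesis using that by simp
  qed
  moreover have "(\<Sum>k<n. U $$ (k,i) * U $$ (k,j)) = of_bool (i = j)" if "i < n" "j < n" for i j
    using arg_cong[OF UU, of "\<lambda>M. M $$ (i,j)"] that U
    by (simp add: scalar_prod_def atLeast0LessThan)
  moreover have "(\<Sum>i<n. U $$ (k,i) * U $$ (l,i)) = of_bool (k = l)" if "k < n" "l < n" for k l
    using arg_cong[OF UU', of "\<lambda>M. M $$ (k,l)"] that U
    by (simp add: scalar_prod_def atLeast0LessThan)
  ultimately have "orthonormal_eigenbasis n (\<lambda>k l. A $$ (k,l)) (\<lambda>i k. U $$ (k,i)) (\<lambda>i. D $$ (i,i))"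
    by (simp add: orthonormal_eigenbasis_def)
  with roots show ?thesis by blast
qed

text \<open>
  The common source of the Parseval identity (\<open>c = 1\<close>) and of the diagonal form of a
  quadratic form (\<open>c\<close> the eigenvalues).
\<close>

lemma sum_squared_coefficients:
  fixes u :: "nat \<Rightarrow> nat \<Rightarrow> real"
  shows "(\<Sum>i<n. c i * (\<Sum>k<n. u i k * x k)\<^sup>2) =
         (\<Sum>k<n. \<Sum>l<n. x k * (\<Sum>i<n. c i * u i k * u i l) * x l)"
proof -
  have "(\<Sum>i<n. c i * (\<Sum>k<n. u i k * x k)\<^sup>2) =
        (\<Sum>i<n. \<Sum>k<n. \<Sum>l<n. c i * u i k * u i l * x k * x l)"
    by (simp add: power2_eq_square sum_product sum_distrib_left mult_ac)
  also have "\<dots> = (\<Sum>k<n. \<Sum>i<n. \<Sum>l<n. c i * u i k * u i l * x k * x l)"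
    by (rule sum.swap)
  also have "\<dots> = (\<Sum>k<n. \<Sum>l<n. \<Sum>i<n. c i * u i k * u i l * x k * x l)"
    by (intro sum.cong refl sum.swap)
  finally show ?thesis by (simp add: sum_distrib_left sum_distrib_right mult_ac)
qed

context
  fixes n A u e
  assumes basis: "orthonormal_eigenbasis n A u e"
begin

lemma eigenbasis_parseval: "(\<Sum>i<n. (\<Sum>k<n. u i k * x k)\<^sup>2) = (\<Sum>k<n. (x k)\<^sup>2)"
proof -
  have "(\<Sum>i<n. (\<Sum>k<n. u i k * x k)\<^sup>2) = (\<Sum>k<n. \<Sum>l<n. x k * (\<Sum>i<n. u i k * u i l) * x l)"
    using sum_squared_coefficients[of "\<lambda>_. 1"] by simp
  also have "\<dots> = (\<Sum>k<n. \<Sum>l<n. if l = k then (x k)\<^sup>2 else 0)"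
    using basis by (intro sum.cong) (auto simp: orthonormal_eigenbasis_def power2_eq_square)
  finally show ?thesis by simp
qed

lemma eigenbasis_unit: "i < n \<Longrightarrow> (\<Sum>k<n. (u i k)\<^sup>2) = 1"
  using basis by (simp add: orthonormal_eigenbasis_def power2_eq_square)

lemma eigenbasis_expansion:
  assumes "k < n" "m < n"
  shows "A k m = (\<Sum>i<n. e i * u i k * u i m)"
proof -
  have "(\<Sum>i<n. e i * u i k * u i m) = (\<Sum>i<n. (\<Sum>l<n. A k l * u i l) * u i m)"
    using basis assms by (simp add: orthonormal_eigenbasis_def)
  also have "\<dots> = (\<Sum>l<n. A k l * (\<Sum>i<n. u i l * u i m))"
    by (subst sum_distrib_right, subst sum.swap) (simp add: sum_distrib_left mult_ac)
  also have "\<dots> = (\<Sum>l<n. if l = m then A k m else 0)"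
    using basis assms by (intro sum.cong) (auto simp: orthonormal_eigenbasis_def)
  finally show ?thesis using assms by simp
qed

lemma eigenbasis_quadratic_form:
  "quadratic_form n A x = (\<Sum>i<n. e i * (\<Sum>k<n. u i k * x k)\<^sup>2)"
  unfolding sum_squared_coefficients quadratic_form_def
  by (intro sum.cong refl) (simp add: eigenbasis_expansion)

lemma eigenbasis_eigenvalue: 
  assumes i: "i < n"
  shows "quadratic_form n A (u i) = e i"
proof -
  have "quadratic_form n A (u i) = (\<Sum>j<n. if j = i then e i else 0)"
    unfolding eigenbasis_quadratic_form
    using basis i by (intro sum.cong) (auto simp: orthonormal_eigenbasis_def)
  thus ?thesis using i by simp
qed

text \<open>
  Eigenvectors of a nonzero eigenvalue are orthogonal to the kernel. The symmetry of \<open>A\<close> that this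
  needs is read off from the spectral expansion.
\<close>

lemma eigenbasis_orthogonal_kernel:
  assumes i: "i < n" and e: "e i \<noteq> 0" and x: "\<And>k. k < n \<Longrightarrow> (\<Sum>l<n. A k l * x l) = 0"
  shows "(\<Sum>k<n. u i k * x k) = 0"
proof -
  have sym: "A k l = A l k" if "k < n" "l < n" for k l
    using that by (simp add: eigenbasis_expansion mult_ac)
  have "e i * (\<Sum>k<n. u i k * x k) = (\<Sum>k<n. (\<Sum>l<n. A k l * u i l) * x k)"
    using basis i by (simp add: orthonormal_eigenbasis_def sum_distrib_left mult_ac)
  also have "\<dots> = (\<Sum>l<n. u i l * (\<Sum>k<n. A l k * x k))"
    by (subst sum_distrib_right, subst sum.swap) (simp add: sum_distrib_left mult_ac sym)
  also have "\<dots> = 0" using x by simp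
  finally show ?thesis using e by simp
qed

text \<open>
  The values at \<open>k\<close> and at \<open>l\<close> of the eigenvectors form orthonormal vectors, so they
  cannot coincide.
\<close>

lemma eigenbasis_separates_points:
  assumes "k < n" "l < n" "\<And>i. i < n \<Longrightarrow> u i k = u i l"
  shows "k = l"
proof (rule ccontr)
  assume "k \<noteq> l"
  hence "(\<Sum>i<n. u i k * u i l) = 0" "(\<Sum>i<n. u i k * u i k) = 1"
    using basis assms(1,2) by (auto simp: orthonormal_eigenbasis_def)
  moreover have "(\<Sum>i<n. u i k * u i l) = (\<Sum>i<n. u i k * u i k)"
    using assms(3) by simp
  ultimately show False by simp
qed

end

section \<open>Monotonicity of convex decreasing spectral sums\<close>

text \<open>
  The hypothesis \<open>tangent\<close> with \<open>g > 0\<close> is convexity and strict monotonicity of \<open>f\<close> in one: the graph of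
  \<open>f\<close> lies above its tangent of slope \<open>- g y\<close> at every \<open>y > 0\<close>. Averaging that tangent inequality at the
  eigenvalue \<open>b j\<close> with the weights \<open>s i j\<close> makes the linear term equal to the defect
  \<open>b j - v j \<bullet> A (v j)\<close>, which is nonnegative because \<open>A \<le> B\<close>. As \<open>g > 0\<close>, equality of the
  sums forces every defect to vanish. If \<open>b j = 0\<close>, then \<open>f (b j) = 0\<close> is trivially a lower bound, and the
  defect is zero because \<open>0 \<le> A \<le> B\<close>.
\<close>

lemma spectral_sum_antimono:
  assumes A: "orthonormal_eigenbasis n A u a" and B: "orthonormal_eigenbasis n B v b"
    and a0: "\<And>i. i < n \<Longrightarrow> a i \<ge> 0"
    and le: "\<And>x. quadratic_form n A x \<le> quadratic_form n B x"
    and ker: "\<And>i k. i < n \<Longrightarrow> a i = 0 \<Longrightarrow> k < n \<Longrightarrow> (\<Sum>l<n. B k l * u i l) = 0"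
    and f0: "f 0 = 0" and fpos: "\<And>x. x > 0 \<Longrightarrow> f x \<ge> 0"
    and g: "\<And>y. y > 0 \<Longrightarrow> g y > 0"
    and tangent: "\<And>x y. x > 0 \<Longrightarrow> y > 0 \<Longrightarrow> f y - g y * (x - y) \<le> f x"
  shows "(\<Sum>j<n. f (b j)) \<le> (\<Sum>i<n. f (a i))"
    and "(\<Sum>j<n. f (b j)) = (\<Sum>i<n. f (a i)) \<Longrightarrow> j < n \<Longrightarrow>
           quadratic_form n A (v j) = quadratic_form n B (v j)"
proof -
  define s where "s i j = (\<Sum>k<n. u i k * v j k)\<^sup>2" for i j
  have s_row: "(\<Sum>i<n. s i j) = 1" if "j < n" for j
    unfolding s_def eigenbasis_parseval[OF A] by (rule eigenbasis_unit[OF B that])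
  have s_col: "(\<Sum>j<n. s i j) = 1" if "i < n" for i
    unfolding s_def using eigenbasis_parseval[OF B, of "u i"] eigenbasis_unit[OF A that]
    by (simp add: mult.commute)
  have qA: "quadratic_form n A (v j) = (\<Sum>i<n. a i * s i j)" for j
    unfolding s_def by (rule eigenbasis_quadratic_form[OF A])
  have qA0: "quadratic_form n A (v j) \<ge> 0" for j
    unfolding qA using a0 by (auto intro!: sum_nonneg simp: s_def)
  have qB: "quadratic_form n B (v j) = b j" if "j < n" for j
    by (rule eigenbasis_eigenvalue[OF B that])
  have b0: "b j \<ge> 0" if "j < n" for j
    using le[of "v j"] qA0[of j] qB[OF that] by linarith
  have key: "f (b j) + g (b j) * (b j - quadratic_form n A (v j)) \<le> (\<Sum>i<n. s i j * f (a i))"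
    if j: "j < n" and bj: "b j > 0" for j
  proof -
    have "f (b j) + g (b j) * (b j - quadratic_form n A (v j)) =
          (f (b j) + g (b j) * b j) * (\<Sum>i<n. s i j) - g (b j) * (\<Sum>i<n. a i * s i j)"
      using s_row[OF j] qA[of j] by (simp add: algebra_simps)
    also have "\<dots> = (\<Sum>i<n. s i j * (f (b j) - g (b j) * (a i - b j)))"
      by (simp add: sum_distrib_left sum_subtractf sum.distrib algebra_simps)
    also have "\<dots> \<le> (\<Sum>i<n. s i j * f (a i))"
    proof (rule sum_mono)
      fix i assume "i \<in> {..<n}"
      hence i: "i < n" by simp
      show "s i j * (f (b j) - g (b j) * (a i - b j)) \<le> s i j * f (a i)"
      proof (cases "a i = 0")
        case True
        \<comment> \<open>Here the tangent inequality is unavailable, and orthogonality removes the term.\<close>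
        have "s i j = 0"
          using eigenbasis_orthogonal_kernel[OF B j, of "u i"] bj ker[OF i True]
          by (simp add: s_def mult.commute)
        thus ?thesis by simp
      next
        case False
        hence "a i > 0" using a0[OF i] by simp
        thus ?thesis using tangent[OF _ bj] by (intro mult_left_mono) (auto simp: s_def)
      qed
    qed
    finally show ?thesis .
  qed
  have f_nonneg: "f (a i) \<ge> 0" if "i < n" for i
    using a0[OF that] fpos[of "a i"] f0 by (cases "a i = 0") auto
  have row: "f (b j) \<le> (\<Sum>i<n. s i j * f (a i))" if j: "j < n" for j
  proof (cases "b j = 0")
    case True
    thus ?thesis using f_nonneg f0 by (auto intro!: sum_nonneg simp: s_def)
  next
    case False
    hence bj: "b j > 0" using b0[OF j] by simp
    have "g (b j) * (b j - quadratic_form n A (v j)) \<ge> 0"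
      using g[OF bj] le[of "v j"] qB[OF j] by simp
    thus ?thesis using key[OF j bj] by linarith
  qed
  have total: "(\<Sum>j<n. \<Sum>i<n. s i j * f (a i)) = (\<Sum>i<n. f (a i))"
    by (subst sum.swap) (simp add: sum_distrib_right[symmetric] s_col)
  show "(\<Sum>j<n. f (b j)) \<le> (\<Sum>i<n. f (a i))"
    unfolding total[symmetric] using row by (intro sum_mono) auto
  assume eq: "(\<Sum>j<n. f (b j)) = (\<Sum>i<n. f (a i))" and j: "j < n"
  have "(\<Sum>j<n. (\<Sum>i<n. s i j * f (a i)) - f (b j)) = 0"
    by (simp add: sum_subtractf total eq)
  hence tight: "(\<Sum>i<n. s i j * f (a i)) = f (b j)"
    using row j by (subst (asm) sum_nonneg_eq_0_iff) auto
  show "quadratic_form n A (v j) = quadratic_form n B (v j)"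
  proof (cases "b j = 0")
    case True
    thus ?thesis using le[of "v j"] qA0[of j] qB[OF j] by simp
  next
    case False
    hence bj: "b j > 0" using b0[OF j] by simp
    have "g (b j) * (b j - quadratic_form n A (v j)) \<le> 0"
      using key[OF j bj] tight by simp
    hence "b j \<le> quadratic_form n A (v j)" using g[OF bj]
      by (simp add: mult_le_0_iff)
    thus ?thesis using le[of "v j"] qB[OF j] by simp
  qed
qed

lemma tangent_inverse:
  fixes x y :: real
  assumes "x > 0" "y > 0"
  shows "1 / y - 1 / y\<^sup>2 * (x - y) \<le> 1 / x"
proof -
  have "1 / x - (1 / y - 1 / y\<^sup>2 * (x - y)) = (x - y)\<^sup>2 / (x * y\<^sup>2)"
    using assms by (simp add: field_simps power2_eq_square)
  also have "\<dots> \<ge> 0" using assms by simp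
  finally show ?thesis by simp
qed

lemma tangent_inverse_square:
  fixes x y :: real
  assumes "x > 0" "y > 0"
  shows "1 / y\<^sup>2 - 2 / y ^ 3 * (x - y) \<le> 1 / x\<^sup>2"
proof -
  have "1 / x\<^sup>2 - (1 / y\<^sup>2 - 2 / y ^ 3 * (x - y)) = (x - y)\<^sup>2 * (2 * x + y) / (x\<^sup>2 * y ^ 3)"
    using assms by (simp add: field_simps power2_eq_square power3_eq_cube)
  also have "\<dots> \<ge> 0" using assms by simp
  finally show ?thesis by simp
qed

section \<open>Laplacians of weighted graphs\<close>

lemma weight_nonneg: "weighted_graph n G \<Longrightarrow> weight G e \<ge> 0"
  by (cases "e \<in> edges G") (auto simp: weighted_graph_def intro: less_imp_le)

lemma weight_loop: "weighted_graph n G \<Longrightarrow> weight G {i} = 0"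
  by (force simp: weighted_graph_def)

text \<open>
  The edges at \<open>i\<close> correspond to the neighbours of \<open>i\<close>, and all other pairs have weight zero. Summing over
  nodes removes the edge set from all further calculations.
\<close>

lemma weighted_degree_eq_sum:
  assumes G: "weighted_graph n G"
  shows "weighted_degree G i = (\<Sum>j<n. weight G {i, j})"
proof -
  let ?N = "{j. j < n \<and> {i, j} \<in> edges G}"
  have "bij_betw (\<lambda>j. {i, j}) ?N {e \<in> edges G. i \<in> e}"
  proof (rule bij_betwI')
    fix e assume e: "e \<in> {e \<in> edges G. i \<in> e}"
    hence "card e = 2" "e \<subseteq> {..<n}" using G by (auto simp: weighted_graph_def)
    then obtain x y where "e = {x, y}" "x < n" "y < n" by (auto simp: card_2_iff)
    with e show "\<exists>j\<in>?N. e = {i, j}" by (auto simp: insert_commute)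
  qed (auto simp: doubleton_eq_iff)
  hence "weighted_degree G i = (\<Sum>j\<in>?N. weight G {i, j})"
    unfolding weighted_degree_def by (rule sum.reindex_bij_betw[symmetric])
  also have "\<dots> = (\<Sum>j<n. weight G {i, j})"
    using G by (intro sum.mono_neutral_left) (auto simp: weighted_graph_def)
  finally show ?thesis .
qed

lemma laplacian_carrier: "laplacian n G \<in> carrier_mat n n"
  unfolding laplacian_def adjacency_matrix_def by (intro minus_carrier_mat) simp

lemma laplacian_entry:
  assumes "weighted_graph n G" "i < n" "j < n"
  shows "laplacian n G $$ (i,j) = of_bool (i = j) * (\<Sum>k<n. weight G {i, k}) - weight G {i, j}"
  using assms
  by (auto simp: laplacian_def adjacency_matrix_def weighted_degree_eq_sum mat_diag_def weighted_graph_def)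

lemma laplacian_symmetric:
  assumes "weighted_graph n G"
  shows "(laplacian n G)\<^sup>T = laplacian n G"
proof (rule eq_matI)
  fix i j assume "i < dim_row (laplacian n G)" "j < dim_col (laplacian n G)"
  hence "i < n" "j < n" using laplacian_carrier[of n G] by auto
  thus "(laplacian n G)\<^sup>T $$ (i,j) = laplacian n G $$ (i,j)"
    using assms laplacian_carrier[of n G] by (auto simp: laplacian_entry insert_commute)
qed (use laplacian_carrier[of n G] in auto)

lemma laplacian_apply:
  assumes "weighted_graph n G" "i < n"
  shows "(\<Sum>j<n. laplacian n G $$ (i,j) * x j) = (\<Sum>j<n. weight G {i, j} * (x i - x j))"
proof -
  have "(\<Sum>j<n. laplacian n G $$ (i,j) * x j) =
        (\<Sum>j<n. (if j = i then (\<Sum>k<n. weight G {i, k}) * x i else 0) - weight G {i, j} * x j)"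
    using assms by (intro sum.cong) (auto simp: laplacian_entry algebra_simps)
  thus ?thesis using assms(2)
    by (simp add: sum_subtractf sum_distrib_left sum_distrib_right algebra_simps)
qed

text \<open>
  Every edge is counted twice in the double sum, whence the factor one half.
\<close>

lemma laplacian_quadratic_form:
  assumes "weighted_graph n G"
  shows "quadratic_form n (\<lambda>i j. laplacian n G $$ (i,j)) x =
         (\<Sum>i<n. \<Sum>j<n. weight G {i, j} * (x i - x j)\<^sup>2) / 2"
proof -
  let ?S = "\<Sum>i<n. \<Sum>j<n. weight G {i, j} * (x i - x j) * x i"
  have "quadratic_form n (\<lambda>i j. laplacian n G $$ (i,j)) x =
        (\<Sum>i<n. x i * (\<Sum>j<n. laplacian n G $$ (i,j) * x j))"
    by (simp add: quadratic_form_def sum_distrib_left mult_ac)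
  also have "\<dots> = ?S"
    by (intro sum.cong refl, subst laplacian_apply[OF assms])
      (simp_all add: sum_distrib_left mult_ac)
  finally have 1: "quadratic_form n (\<lambda>i j. laplacian n G $$ (i,j)) x = ?S" .
  have 2: "?S = (\<Sum>i<n. \<Sum>j<n. weight G {i, j} * (x j - x i) * x j)"
    by (subst sum.swap) (simp add: insert_commute)
  have "2 * ?S = ?S + (\<Sum>i<n. \<Sum>j<n. weight G {i, j} * (x j - x i) * x j)"
    using 2 by simp
  also have "\<dots> = (\<Sum>i<n. \<Sum>j<n. weight G {i, j} * (x i - x j)\<^sup>2)"
    by (simp add: sum.distrib[symmetric] power2_eq_square algebra_simps)
  finally show ?thesis using 1 by simp
qed

lemma laplacian_quadratic_form_eq_0D:
  assumes G: "weighted_graph n G"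
    and 0: "quadratic_form n (\<lambda>i j. laplacian n G $$ (i,j)) x = 0"
    and e: "{i, j} \<in> edges G"
  shows "x i = x j"
proof -
  have ij: "i < n" "j < n" "weight G {i, j} > 0" using G e by (auto simp: weighted_graph_def)
  have nn: "weight G {i, j} * (x i - x j)\<^sup>2 \<ge> 0" for i j
    using weight_nonneg[OF G] by simp
  have "(\<Sum>i<n. \<Sum>j<n. weight G {i, j} * (x i - x j)\<^sup>2) = 0"
    using 0 laplacian_quadratic_form[OF G] by simp
  hence "(\<Sum>j<n. weight G {i, j} * (x i - x j)\<^sup>2) = 0"
    using ij nn by (subst (asm) sum_nonneg_eq_0_iff) (auto intro!: sum_nonneg)
  hence "\<forall>j\<in>{..<n}. weight G {i, j} * (x i - x j)\<^sup>2 = 0"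
    using nn by (subst (asm) sum_nonneg_eq_0_iff) auto
  thus ?thesis using ij by force
qed

lemma connected_laplacian_kernel_constant:
  assumes G: "weighted_graph n G" and conn: "connected_graph n G"
    and 0: "quadratic_form n (\<lambda>i j. laplacian n G $$ (i,j)) x = 0"
    and "i < n" "j < n"
  shows "x i = x j"
proof -
  have "(i, j) \<in> {(u, v). {u, v} \<in> edges G}\<^sup>*"
    using conn assms by (auto simp: connected_graph_def)
  thus ?thesis
    by (induction rule: rtrancl_induct) (use laplacian_quadratic_form_eq_0D[OF G 0] in auto)
qed

lemma laplacian_eigenvalue_nonneg:
  assumes G: "weighted_graph n G"
    and basis: "orthonormal_eigenbasis n (\<lambda>i j. laplacian n G $$ (i,j)) u e" and "i < n"
  shows "e i \<ge> 0"
  using eigenbasis_eigenvalue[OF basis \<open>i < n\<close>] laplacian_quadratic_form[OF G, of "u i"]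
    weight_nonneg[OF G]
  by (metis (no_types, lifting) divide_nonneg_nonneg mult_nonneg_nonneg sum_nonneg zero_le_numeral zero_le_power2)

text \<open>
  The constant vector lies in the kernel. If no eigenvalue vanished, it would be orthogonal to the
  whole eigenbasis, so zero by Parseval.
\<close>

lemma laplacian_zero_eigenvalue:
  assumes G: "weighted_graph n G" and n: "n \<ge> 1"
    and basis: "orthonormal_eigenbasis n (\<lambda>i j. laplacian n G $$ (i,j)) u e"
  shows "\<exists>i<n. e i = 0"
proof (rule ccontr)
  assume "\<not> (\<exists>i<n. e i = 0)"
  hence "(\<Sum>k<n. u i k * 1) = 0" if "i < n" for i
    using eigenbasis_orthogonal_kernel[OF basis that, of "\<lambda>_. 1"] that laplacian_apply[OF G, of _ "\<lambda>_. 1"]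
    by simp
  hence "(\<Sum>k<n. (1::real)\<^sup>2) = 0"
    by (subst eigenbasis_parseval[OF basis, symmetric]) simp
  thus False using n by simp
qed

text \<open>
  The first entry of the sorted list is the minimum, which is zero, and \<open>f\<close> ignores it. Since the index
  \<open>i\<close> counts from one, \<open>i = 2\<close> reads the second entry.
\<close>

lemma sum_sorted_tail:
  fixes M :: "real multiset" and f :: "real \<Rightarrow> real"
  assumes nonneg: "\<And>x. x \<in># M \<Longrightarrow> x \<ge> 0" and 0: "0 \<in># M" and f0: "f 0 = 0"
  shows "(\<Sum>i = 2..size M. f (sorted_list_of_multiset M ! (i - 1))) = sum_mset (image_mset f M)"
proof -
  let ?xs = "sorted_list_of_multiset M"
  have len: "length ?xs = size M" by (metis mset_sorted_list_of_multiset size_mset)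
  have set: "set ?xs = set_mset M" by simp
  have srt: "sorted ?xs" by simp
  have M: "size M > 0" using 0 by (metis gr0I empty_iff set_mset_empty size_eq_0_iff_empty)
  have ne: "?xs \<noteq> []" using 0 set by force
  obtain k where k: "k < length ?xs" "?xs ! k = 0" using 0 set by (metis in_set_conv_nth)
  have "?xs ! 0 \<le> 0" using sorted_nth_mono[OF srt, of 0 k] k by simp
  moreover have "?xs ! 0 \<in># M" using ne by (metis set nth_mem length_greater_0_conv)
  ultimately have hd0: "?xs ! 0 = 0" using nonneg by force
  have "(\<Sum>i = 2..size M. f (?xs ! (i - 1))) = (\<Sum>i = 1..<size M. f (?xs ! i))"
    by (rule sum.reindex_bij_witness[of _ Suc "\<lambda>i. i - 1"]) auto
  also have "\<dots> = (\<Sum>i = 0..<size M. f (?xs ! i))"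
    using M hd0 f0 by (subst (2) sum.atLeast_Suc_lessThan) (auto simp: Suc_le_eq)
  also have "\<dots> = sum_list (map f ?xs)"
    by (simp add: sum_list_sum_nth len)
  also have "\<dots> = sum_mset (image_mset f (mset ?xs))"
    by (metis mset_map sum_mset_sum_list)
  finally show ?thesis by simp
qed

lemma sum_laplacian_eigenvalues:
  fixes f :: "real \<Rightarrow> real"
  assumes G: "weighted_graph n G" and n: "n \<ge> 1"
    and basis: "orthonormal_eigenbasis n (\<lambda>i j. laplacian n G $$ (i,j)) u e"
    and roots: "proots (char_poly (laplacian n G)) = image_mset e (mset_set {..<n})"
    and f0: "f 0 = 0"
  shows "(\<Sum>i = 2..n. f (laplacian_eigenvalue n G i)) = (\<Sum>i<n. f (e i))"
proof -
  let ?M = "proots (char_poly (laplacian n G))"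
  have "size ?M = n" by (simp add: roots)
  moreover have "0 \<in># ?M" using laplacian_zero_eigenvalue[OF G n basis] by (auto simp: roots)
  moreover have "x \<ge> 0" if "x \<in># ?M" for x
    using that laplacian_eigenvalue_nonneg[OF G basis] by (auto simp: roots)
  ultimately show ?thesis using sum_sorted_tail[of ?M f] f0
    by (simp add: laplacian_eigenvalue_def roots sum_unfold_sum_mset image_mset.compositionality comp_def)
qed

section \<open>Comparison with a spanning subgraph\<close>

lemma spanning_subgraph_weight_le:
  assumes "weighted_graph n G" "weighted_graph n P" "spanning_subgraph P G"
  shows "weight P e \<le> weight G e"
  using assms weight_nonneg[OF assms(1), of e]
  by (cases "e \<in> edges P") (auto simp: spanning_subgraph_def weighted_graph_def)

lemma spanning_subgraph_eqI:
  assumes G: "weighted_graph n G" and P: "weighted_graph n P" and sub: "spanning_subgraph P G"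
    and edges: "edges G \<subseteq> edges P"
  shows "G = P"
proof -
  have "edges G = edges P" using sub edges by (auto simp: spanning_subgraph_def)
  moreover have "weight G = weight P"
    using calculation G P sub
    by (intro ext) (metis spanning_subgraph_def weighted_graph_def)
  ultimately show ?thesis by simp
qed

text \<open>
  Monotonicity of spectral sums for \<open>L\<^sub>P \<le> L\<^sub>G\<close>. When the sums agree, the quadratic forms agree on an
  eigenbasis of \<open>L\<^sub>G\<close>; their difference is a sum of nonnegative terms, so each eigenvector is constant
  along every edge missing in \<open>P\<close>, and an eigenbasis separates the end points of an edge.
\<close>

lemma laplacian_spectral_sum_subgraph:
  fixes f g :: "real \<Rightarrow> real"
  assumes n: "n \<ge> 1" and G: "weighted_graph n G" and P: "weighted_graph n P"
    and conn: "connected_graph n P" and sub: "spanning_subgraph P G"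
    and f0: "f 0 = 0" and fpos: "\<And>x. x > 0 \<Longrightarrow> f x \<ge> 0"
    and g: "\<And>y. y > 0 \<Longrightarrow> g y > 0"
    and tangent: "\<And>x y. x > 0 \<Longrightarrow> y > 0 \<Longrightarrow> f y - g y * (x - y) \<le> f x"
  shows "(\<Sum>i = 2..n. f (laplacian_eigenvalue n G i)) \<le> (\<Sum>i = 2..n. f (laplacian_eigenvalue n P i))"
    and "(\<Sum>i = 2..n. f (laplacian_eigenvalue n G i)) = (\<Sum>i = 2..n. f (laplacian_eigenvalue n P i))
           \<longleftrightarrow> G = P"
proof -
  let ?G = "\<lambda>i j. laplacian n G $$ (i,j)" and ?P = "\<lambda>i j. laplacian n P $$ (i,j)"
  obtain v b where v: "orthonormal_eigenbasis n ?G v b"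
    and b: "proots (char_poly (laplacian n G)) = image_mset b (mset_set {..<n})"
    using real_symmetric_eigenbasis[OF laplacian_carrier laplacian_symmetric[OF G]] by blast
  obtain u a where u: "orthonormal_eigenbasis n ?P u a"
    and a: "proots (char_poly (laplacian n P)) = image_mset a (mset_set {..<n})"
    using real_symmetric_eigenbasis[OF laplacian_carrier laplacian_symmetric[OF P]] by blast
  note sums = sum_laplacian_eigenvalues[OF G n v b, of f, OF f0] sum_laplacian_eigenvalues[OF P n u a, of f, OF f0]
  have le: "quadratic_form n ?P x \<le> quadratic_form n ?G x" for x
    unfolding laplacian_quadratic_form[OF G] laplacian_quadratic_form[OF P]
    using spanning_subgraph_weight_le[OF G P sub]
    by (intro divide_right_mono sum_mono mult_right_mono) auto
  have ker: "(\<Sum>l<n. ?G k l * u i l) = 0" if "i < n" "a i = 0" "k < n" for i k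
  proof -
    have "quadratic_form n ?P (u i) = 0" using eigenbasis_eigenvalue[OF u] that by simp
    hence "u i k = u i l" if "l < n" for l
      using connected_laplacian_kernel_constant[OF P conn] \<open>k < n\<close> that by blast
    thus ?thesis using laplacian_apply[OF G \<open>k < n\<close>] by simp
  qed
  note anti = spectral_sum_antimono[where f = f and g = g, OF u v
      laplacian_eigenvalue_nonneg[OF P u] le ker f0 fpos g tangent]
  show "(\<Sum>i = 2..n. f (laplacian_eigenvalue n G i)) \<le> (\<Sum>i = 2..n. f (laplacian_eigenvalue n P i))"
    unfolding sums by (rule anti(1))
  show "(\<Sum>i = 2..n. f (laplacian_eigenvalue n G i)) = (\<Sum>i = 2..n. f (laplacian_eigenvalue n P i))
           \<longleftrightarrow> G = P"
  proof
    assume eq: "(\<Sum>i = 2..n. f (laplacian_eigenvalue n G i)) = (\<Sum>i = 2..n. f (laplacian_eigenvalue n P i))"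
    have q: "quadratic_form n ?P (v j) = quadratic_form n ?G (v j)" if "j < n" for j
      using anti(2) eq that unfolding sums by blast
    have "{k, l} \<in> edges P" if "{k, l} \<in> edges G" for k l
    proof (rule ccontr)
      assume nP: "{k, l} \<notin> edges P"
      have kl: "k < n" "l < n" "weight G {k, l} > 0" "weight P {k, l} = 0" "k \<noteq> l"
        using G P that nP by (auto simp: weighted_graph_def)
      have "v j k = v j l" if j: "j < n" for j
      proof -
        let ?d = "\<lambda>k l. (weight G {k, l} - weight P {k, l}) * (v j k - v j l)\<^sup>2"
        have nn: "?d k l \<ge> 0" for k l
          using spanning_subgraph_weight_le[OF G P sub] by simp
        have "(\<Sum>k<n. \<Sum>l<n. ?d k l) = 0"
          using q[OF j] laplacian_quadratic_form[OF G] laplacian_quadratic_form[OF P]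
          by (simp add: algebra_simps sum_subtractf)
        hence "(\<Sum>l<n. ?d k l) = 0"
          using kl nn by (subst (asm) sum_nonneg_eq_0_iff) (auto intro!: sum_nonneg)
        hence "\<forall>l\<in>{..<n}. ?d k l = 0"
          using nn by (subst (asm) sum_nonneg_eq_0_iff) auto
        thus ?thesis using kl by force
      qed
      thus False using eigenbasis_separates_points[OF v kl(1,2)] kl(5) by blast
    qed
    moreover have "\<exists>k l. e = {k, l}" if "e \<in> edges G" for e
      using G that by (simp add: weighted_graph_def subset_iff) (metis card_2_iff)
    ultimately have "edges G \<subseteq> edges P" by blast
    thus "G = P" by (rule spanning_subgraph_eqI[OF G P sub])
  qed simp
qed

theorem theorem16:
  fixes n :: nat and \<beta> :: real and G P :: wgraph
  assumes "n \<ge> 1"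
    and "\<beta> > 0"
    and "weighted_graph n G" and "connected_graph n G"
    and "weighted_graph n P" and "connected_graph n P"
    and "spanning_subgraph P G"
  shows "rho_ss_position n \<beta> G \<le> rho_ss_position n \<beta> P
    \<and> rho_ss_velocity n \<beta> G \<le> rho_ss_velocity n \<beta> P
    \<and> (rho_ss_position n \<beta> G = rho_ss_position n \<beta> P \<longleftrightarrow> G = P)
    \<and> (rho_ss_velocity n \<beta> G = rho_ss_velocity n \<beta> P \<longleftrightarrow> G = P)"
proof -
  note sub = laplacian_spectral_sum_subgraph[OF assms(1,3,5,6,7)]
  note pos = sub[of "\<lambda>x. 1 / x\<^sup>2" "\<lambda>y. 2 / y ^ 3", OF _ _ _ tangent_inverse_square]
  note vel = sub[of "\<lambda>x. 1 / x" "\<lambda>y. 1 / y\<^sup>2", OF _ _ _ tangent_inverse]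
  show ?thesis
    unfolding rho_ss_position_def rho_ss_velocity_def
    using assms(2) pos vel by (simp add: divide_right_mono)
qed

end
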